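(* Let $\Gamma$ be a connected signed graph whose adjacency matrix $A(\Gamma)$ has exactly $m$ distinct eigenvalues. Then ${\rm diam}^{\pm}(\Gamma)\leq m-1$.
   Context: A signed graph $\Gamma=(G,\sigma)$ is a simple graph $G=(V,E)$ with a map $\sigma:E\to\{+1,-1\}$; it is connected if $G$ is. Its adjacency matrix $A=A(\Gamma)$ has $(i,j)$ entry $\sigma(ij)$ if $ij\in E$ and $0$ otherwise; thus the $(s,t)$ entry of $A^k$ equals the number of positive walks of length $k$ from $s$ to $t$ minus the number of negative ones (a walk is positive/negative according to the product of the signs of its edges). For vertices $s,t$ at distance $k$ in $G$, their signed distance is $k$ if $(A^k)_{st}\neq0$, and $0$ otherwise. The signed diameter ${\rm diam}^{\pm}(\Gamma)$ is the largest signed distance between two vertices of $\Gamma$. *)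

theory Defs
  imports "Graph_Theory.Graph_Theory" "Jordan_Normal_Form.Spectral_Radius"
begin

text \<open>
  A finite simple graph is a symmetric loop-free pair digraph: each edge \<open>uv\<close> is represented by
  the two arcs \<open>(u, v)\<close> and \<open>(v, u)\<close>. The sign is a function of the unordered edge \<open>{u, v}\<close>;
  its values outside the edge set are irrelevant.
\<close>

locale signed_graph = pair_graph G for G :: "'a pair_pre_digraph" +
  fixes \<sigma> :: "'a set \<Rightarrow> real"
  assumes sign: "(u, v) \<in> parcs G \<Longrightarrow> \<sigma> {u, v} \<in> {1, -1}"

text \<open>
  Matrices are indexed by natural numbers, so \<open>vs\<close> lists the vertices without repetition:
  row and column \<open>i\<close> belong to the vertex \<open>vs ! i\<close>.
\<close>

definition adj_matrix :: "'a pair_pre_digraph \<Rightarrow> ('a set \<Rightarrow> real) \<Rightarrow> 'a list \<Rightarrow> real mat" where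
  "adj_matrix G \<sigma> vs = mat (length vs) (length vs)
     (\<lambda>(i, j). if (vs ! i, vs ! j) \<in> parcs G then \<sigma> {vs ! i, vs ! j} else 0)"

text \<open>Only meaningful if \<open>v\<close> is reachable from \<open>u\<close>.\<close>

definition graph_dist :: "'a pair_pre_digraph \<Rightarrow> 'a \<Rightarrow> 'a \<Rightarrow> nat" where
  "graph_dist G u v = (LEAST k. \<exists>p. pre_digraph.awalk (with_proj G) u p v \<and> length p = k)"

definition signed_dist :: "'a pair_pre_digraph \<Rightarrow> ('a set \<Rightarrow> real) \<Rightarrow> 'a list \<Rightarrow> nat \<Rightarrow> nat \<Rightarrow> nat" where
  "signed_dist G \<sigma> vs s t =
     (let k = graph_dist G (vs ! s) (vs ! t)
      in if (adj_matrix G \<sigma> vs ^\<^sub>m k) $$ (s, t) \<noteq> 0 then k else 0)"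

definition signed_diameter :: "'a pair_pre_digraph \<Rightarrow> ('a set \<Rightarrow> real) \<Rightarrow> 'a list \<Rightarrow> nat" where
  "signed_diameter G \<sigma> vs =
     Max {signed_dist G \<sigma> vs s t | s t. s < length vs \<and> t < length vs}"

end

theory Submission
  imports Defs
begin

text \<open>
  A real symmetric matrix \<open>A\<close> is annihilated by the product of \<open>A - \<lambda>\<close> over its distinct
  eigenvalues \<open>\<lambda>\<close>: triangularising \<open>A\<close> over the complex numbers gives some product of linear
  factors that annihilates it, a factor at a non-eigenvalue is injective, and a repeated factor may
  be dropped because \<open>(A - \<lambda>)\<^sup>2 w = 0\<close> implies \<open>(A - \<lambda>) w = 0\<close>. If \<open>s\<close>, \<open>t\<close> are at
  distance \<open>k\<close>, the \<open>(s, t)\<close> entries of all lower powers of \<open>A\<close> vanish. Were the one of \<open>A\<^sup>k\<close>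
  nonzero with \<open>k \<ge> m\<close>, then multiplying the annihilating product by \<open>A\<close> to the power \<open>k - m\<close>
  and expanding would leave exactly that entry, a contradiction.
\<close>

section \<open>Products of linear factors as operators on vectors:
  \<open>foldr (shift A) zs v\<close> applies the factors \<open>A - z\<close>, for \<open>z\<close>
  in \<open>zs\<close>, to \<open>v\<close>\<close>

definition shift :: "'a :: field mat \<Rightarrow> 'a \<Rightarrow> 'a vec \<Rightarrow> 'a vec" where
  "shift A z v = A *\<^sub>v v - z \<cdot>\<^sub>v v"

lemma shift_carrier [simp, intro]:
  "A \<in> carrier_mat n n \<Longrightarrow> v \<in> carrier_vec n \<Longrightarrow> shift A z v \<in> carrier_vec n"
  by (auto simp: shift_def)

lemma foldr_shift_carrier [simp, intro]:
  "A \<in> carrier_mat n n \<Longrightarrow> v \<in> carrier_vec n \<Longrightarrow> foldr (shift A) zs v \<in> carrier_vec n"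
  by (induction zs) auto

text \<open>This serves two purposes: with \<open>P\<close> a change of basis it transports factors
  between similar matrices, and with \<open>P = A = B\<close> it says that \<open>A\<close> commutes
  with its own shifts.\<close>

lemma mult_mat_vec_shift:
  assumes A: "A \<in> carrier_mat n n" and B: "B \<in> carrier_mat n n" and P: "P \<in> carrier_mat n n"
    and "A * P = P * B" and v: "v \<in> carrier_vec n"
  shows "P *\<^sub>v shift B z v = shift A z (P *\<^sub>v v)"
proof -
  have "P *\<^sub>v shift B z v = P *\<^sub>v (B *\<^sub>v v) - P *\<^sub>v (z \<cdot>\<^sub>v v)"
    unfolding shift_def using B P v by (intro mult_minus_distrib_mat_vec[OF P]) auto
  also have "P *\<^sub>v (B *\<^sub>v v) = A *\<^sub>v (P *\<^sub>v v)"
    using assoc_mult_mat_vec[OF P B v] assoc_mult_mat_vec[OF A P v] assms(4) by simp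
  also have "P *\<^sub>v (z \<cdot>\<^sub>v v) = z \<cdot>\<^sub>v (P *\<^sub>v v)"
    using P v by (rule mult_mat_vec)
  finally show ?thesis by (simp add: shift_def)
qed

lemma mult_mat_vec_foldr_shift:
  assumes "A \<in> carrier_mat n n" "B \<in> carrier_mat n n" "P \<in> carrier_mat n n"
    and "A * P = P * B" and "v \<in> carrier_vec n"
  shows "P *\<^sub>v foldr (shift B) zs v = foldr (shift A) zs (P *\<^sub>v v)"
  using assms by (induction zs) (auto simp: mult_mat_vec_shift)

lemma shift_commute:
  assumes A: "A \<in> carrier_mat n n" and v: "v \<in> carrier_vec n"
  shows "shift A y (shift A z v) = shift A z (shift A y v)"
proof -
  \<comment> \<open>The expanded form is symmetric in \<open>y\<close> and \<open>z\<close> up to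
    rearrangement, so expanding both sides of the goal proves it.\<close>
  have *: "shift A y (shift A z v) = A *\<^sub>v (A *\<^sub>v v) - z \<cdot>\<^sub>v (A *\<^sub>v v) - y \<cdot>\<^sub>v (A *\<^sub>v v) + (y * z) \<cdot>\<^sub>v v"
    for y z
  proof -
    have "A *\<^sub>v shift A z v = shift A z (A *\<^sub>v v)"
      by (rule mult_mat_vec_shift[OF A A A _ v]) simp
    then show ?thesis
      unfolding shift_def[of A y] using A v
      by (intro eq_vecI) (auto simp: shift_def algebra_simps)
  qed
  show ?thesis
    unfolding * using A v by (intro eq_vecI) (auto simp: algebra_simps)
qed

lemma foldr_shift_commute:
  assumes "A \<in> carrier_mat n n" "v \<in> carrier_vec n"
  shows "shift A z (foldr (shift A) zs v) = foldr (shift A) zs (shift A z v)"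
proof (induction zs)
  case (Cons y zs)
  then show ?case
    using shift_commute[OF assms(1) foldr_shift_carrier[OF assms], of z y zs] by simp
qed simp

text \<open>Since the factors commute, any one of them can be pulled to the front. A duplicate can
  thus be brought next to its twin.\<close>

lemma foldr_shift_remove1:
  assumes "A \<in> carrier_mat n n" "v \<in> carrier_vec n" "z \<in> set zs"
  shows "foldr (shift A) zs v = shift A z (foldr (shift A) (remove1 z zs) v)"
  using assms(3)
proof (induction zs)
  case (Cons y zs)
  then show ?case
    using shift_commute[OF assms(1) foldr_shift_carrier[OF assms(1,2)], of y z "remove1 z zs"]
    by auto
qed simp

section \<open>Annihilation by a product of linear factors, via triangular form\<close>

lemma upper_triangular_shift_diag:
  assumes B: "B \<in> carrier_mat n n" and up: "upper_triangular B" and v: "v \<in> carrier_vec n"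
    and "k < n" and 0: "\<And>i. k < i \<Longrightarrow> i < n \<Longrightarrow> v $ i = 0" and "k \<le> i" "i < n"
  shows "shift B (B $$ (k, k)) v $ i = 0"
proof -
  have "(B *\<^sub>v v) $ i = (\<Sum>j\<in>{0..<n}. B $$ (i, j) * v $ j)"
    using B v \<open>i < n\<close> by (auto simp: scalar_prod_def)
  \<comment> \<open>Row \<open>i\<close> meets \<open>v\<close> only in column \<open>k\<close>: to
    its left the entries lie below the diagonal of \<open>B\<close>, to its right \<open>v\<close>
    vanishes.\<close>
  also have "\<dots> = (\<Sum>j\<in>{0..<n}. if j = k then B $$ (i, k) * v $ k else 0)"
  proof (rule sum.cong[OF refl])
    fix j assume "j \<in> {0..<n}"
    then consider "j = k" | "j < k" "B $$ (i, j) = 0" | "j > k" "v $ j = 0"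
      using up 0[of j] B \<open>k \<le> i\<close> \<open>i < n\<close> unfolding upper_triangular_def
      by (metis carrier_matD(1) atLeastLessThan_iff linorder_less_linear order.strict_trans2)
    then show "B $$ (i, j) * v $ j = (if j = k then B $$ (i, k) * v $ k else 0)"
      by cases auto
  qed
  also have "\<dots> = B $$ (i, k) * v $ k"
    using \<open>k < n\<close> by simp
  finally have *: "(B *\<^sub>v v) $ i = B $$ (i, k) * v $ k" .
  have "B $$ (i, k) * v $ k = B $$ (k, k) * v $ i"
  proof (cases "i = k")
    case False
    then show ?thesis
      using up 0[of i] B \<open>k \<le> i\<close> \<open>i < n\<close> by (auto simp: upper_triangular_def)
  qed simp
  with * show ?thesis
    using B v \<open>i < n\<close> by (simp add: shift_def)
qed

lemma upper_triangular_annihilated: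
  assumes B: "B \<in> carrier_mat n n" and up: "upper_triangular B" and v: "v \<in> carrier_vec n"
  shows "foldr (shift B) (diag_mat B) v = 0\<^sub>v n"
proof -
  have len: "length (diag_mat B) = n"
    using B by (simp add: diag_mat_def)
  \<comment> \<open>\<open>foldr\<close> applies the factor of the last diagonal entry first. Hence
    the induction descends from \<open>k = n\<close>, where nothing is claimed: each further factor
    clears one more coordinate, until \<open>k = 0\<close> leaves the zero vector.\<close>
  have "k \<le> n \<Longrightarrow> (\<forall>i. k \<le> i \<longrightarrow> i < n \<longrightarrow> foldr (shift B) (drop k (diag_mat B)) v $ i = 0)" for k
  proof (induction "n - k" arbitrary: k)
    case (Suc d)
    then have k: "k < n" and IH:
      "\<forall>i. Suc k \<le> i \<longrightarrow> i < n \<longrightarrow> foldr (shift B) (drop (Suc k) (diag_mat B)) v $ i = 0"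
      by auto
    have "drop k (diag_mat B) = B $$ (k, k) # drop (Suc k) (diag_mat B)"
      using k len B by (subst Cons_nth_drop_Suc[symmetric]) (auto simp: diag_mat_def)
    then show ?case
      using upper_triangular_shift_diag[OF B up _ k, of "foldr (shift B) (drop (Suc k) (diag_mat B)) v"]
        IH B v by auto
  qed auto
  from this[of 0] show ?thesis
    using foldr_shift_carrier[OF B v, of "diag_mat B"] by (intro eq_vecI) auto
qed

lemma complex_mat_annihilated:
  fixes A :: "complex mat"
  assumes A: "A \<in> carrier_mat n n"
  obtains zs where "\<And>v. v \<in> carrier_vec n \<Longrightarrow> foldr (shift A) zs v = 0\<^sub>v n"
proof -
  obtain zs where zs: "char_poly A = (\<Prod>z\<leftarrow>zs. [:- z, 1:])"
    using char_poly_factorized[OF A] by blast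
  obtain B P Q where "schur_decomposition A zs = (B, P, Q)"
    using prod_cases3 by blast
  from schur_decomposition[OF A zs this]
  have wit: "similar_mat_wit A B P Q" and up: "upper_triangular B" and "diag_mat B = zs"
    by blast+
  have B: "B \<in> carrier_mat n n" and P: "P \<in> carrier_mat n n" and Q: "Q \<in> carrier_mat n n"
    and PQ: "P * Q = 1\<^sub>m n" and QP: "Q * P = 1\<^sub>m n" and A_eq: "A = P * B * Q"
    using similar_mat_witD2[OF A wit] by blast+
  have "A * P = P * B * (Q * P)"
    unfolding A_eq using P B Q by (intro assoc_mult_mat) auto
  then have AP: "A * P = P * B"
    using P B by (simp add: QP)
  have "foldr (shift A) zs v = 0\<^sub>v n" if v: "v \<in> carrier_vec n" for v
  proof -
    \<comment> \<open>Writing \<open>v\<close> as \<open>P\<close> applied to \<open>Q v\<close>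
      lets the factors pass through \<open>P\<close> and act on \<open>Q v\<close> in the triangular
      basis.\<close>
    have "foldr (shift A) zs (P *\<^sub>v (Q *\<^sub>v v)) = P *\<^sub>v foldr (shift B) zs (Q *\<^sub>v v)"
      using mult_mat_vec_foldr_shift[OF A B P AP] Q v by simp
    also have "\<dots> = 0\<^sub>v n"
      using upper_triangular_annihilated[OF B up mult_mat_vec_carrier[OF Q v]] \<open>diag_mat B = zs\<close> P
      by (intro eq_vecI) auto
    also have "P *\<^sub>v (Q *\<^sub>v v) = v"
      using assoc_mult_mat_vec[OF P Q v] PQ v by simp
    finally show ?thesis .
  qed
  then show thesis by (rule that)
qed

section \<open>Reduction to one factor per eigenvalue\<close>

lemma shift_eq_zero_iff:
  assumes A: "A \<in> carrier_mat n n" and v: "v \<in> carrier_vec n"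
  shows "shift A z v = 0\<^sub>v n \<longleftrightarrow> A *\<^sub>v v = z \<cdot>\<^sub>v v"
proof
  assume *: "shift A z v = 0\<^sub>v n"
  show "A *\<^sub>v v = z \<cdot>\<^sub>v v"
  proof (intro eq_vecI)
    fix i assume "i < dim_vec (z \<cdot>\<^sub>v v)"
    then show "(A *\<^sub>v v) $ i = (z \<cdot>\<^sub>v v) $ i"
      using arg_cong[OF *, of "\<lambda>w. w $ i"] A v by (simp add: shift_def)
  qed (use A v in auto)
qed (use A v in \<open>auto simp: shift_def\<close>)

text \<open>The hypothesis \<open>semisimple\<close> isolates what symmetry will provide: a squared
  factor has the same kernel as the factor itself.\<close>

lemma foldr_shift_distinct_eigenvalues:
  fixes A :: "complex mat"
  assumes A: "A \<in> carrier_mat n n" and v: "v \<in> carrier_vec n"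
    and semisimple: "\<And>z w. eigenvalue A z \<Longrightarrow> w \<in> carrier_vec n \<Longrightarrow>
      shift A z (shift A z w) = 0\<^sub>v n \<Longrightarrow> shift A z w = 0\<^sub>v n"
    and "foldr (shift A) zs v = 0\<^sub>v n"
  shows "foldr (shift A) (remdups (filter (eigenvalue A) zs)) v = 0\<^sub>v n"
  using assms(2,4)
proof (induction zs arbitrary: v)
  case (Cons z zs)
  let ?zs = "remdups (filter (eigenvalue A) zs)"
  note v = \<open>v \<in> carrier_vec n\<close>
  \<comment> \<open>Moving the head factor inward makes the induction hypothesis applicable to
    \<open>shift A z v\<close> in place of \<open>v\<close>; moving it out again afterwards puts it
    in front of the reduced product.\<close>
  have "foldr (shift A) zs (shift A z v) = 0\<^sub>v n"
    using Cons.prems foldr_shift_commute[OF A v] by simp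
  then have *: "shift A z (foldr (shift A) ?zs v) = 0\<^sub>v n"
    using Cons.IH A v foldr_shift_commute[OF A v] by simp
  consider "\<not> eigenvalue A z" | "eigenvalue A z" "z \<in> set zs" | "eigenvalue A z" "z \<notin> set zs"
    by blast
  then show ?case
  proof cases
    case 1
    have "A *\<^sub>v foldr (shift A) ?zs v = z \<cdot>\<^sub>v foldr (shift A) ?zs v"
      using * shift_eq_zero_iff[OF A foldr_shift_carrier[OF A v]] by blast
    with 1 have "foldr (shift A) ?zs v = 0\<^sub>v n"
      using A foldr_shift_carrier[OF A v, of ?zs] unfolding eigenvalue_def eigenvector_def by blast
    with 1 show ?thesis by simp
  next
    case 2
    \<comment> \<open>The reduced list already contains \<open>z\<close>, so \<open>*\<close> has
      this factor twice in a row and \<open>semisimple\<close> removes one copy.\<close>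
    then have "foldr (shift A) ?zs v = shift A z (foldr (shift A) (remove1 z ?zs) v)"
      by (intro foldr_shift_remove1[OF A v]) auto
    with * 2 show ?thesis
      using semisimple A v by simp
  next
    case 3
    with * show ?thesis by simp
  qed
qed simp

section \<open>Spectral properties of real symmetric matrices\<close>

lemma symmetric_cscalar_prod:
  fixes A :: "real mat"
  assumes A: "A \<in> carrier_mat n n" and sym: "\<And>i j. i < n \<Longrightarrow> j < n \<Longrightarrow> A $$ (i, j) = A $$ (j, i)"
    and v: "v \<in> carrier_vec n" and w: "w \<in> carrier_vec n"
  shows "(map_mat complex_of_real A *\<^sub>v v) \<bullet>c w = v \<bullet>c (map_mat complex_of_real A *\<^sub>v w)"
proof -
  have "(map_mat complex_of_real A *\<^sub>v v) \<bullet>c w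
      = (\<Sum>i\<in>{0..<n}. \<Sum>j\<in>{0..<n}. of_real (A $$ (i, j)) * v $ j * cnj (w $ i))"
    using A v w by (auto simp: scalar_prod_def sum_distrib_right intro!: sum.cong)
  also have "\<dots> = (\<Sum>j\<in>{0..<n}. \<Sum>i\<in>{0..<n}. of_real (A $$ (i, j)) * v $ j * cnj (w $ i))"
    by (rule sum.swap)
  also have "\<dots> = v \<bullet>c (map_mat complex_of_real A *\<^sub>v w)"
    using A v w sym by (auto simp: scalar_prod_def sum_distrib_left intro!: sum.cong)
  finally show ?thesis .
qed

lemma symmetric_eigenvalue_real:
  fixes A :: "real mat"
  assumes A: "A \<in> carrier_mat n n" and sym: "\<And>i j. i < n \<Longrightarrow> j < n \<Longrightarrow> A $$ (i, j) = A $$ (j, i)"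
    and "eigenvalue (map_mat complex_of_real A) z"
  shows "z \<in> complex_of_real ` spectrum A"
proof -
  let ?C = "map_mat complex_of_real A"
  have C: "?C \<in> carrier_mat n n" using A by simp
  obtain v where v: "v \<in> carrier_vec n" "v \<noteq> 0\<^sub>v n" "?C *\<^sub>v v = z \<cdot>\<^sub>v v"
    using assms(3) A by (auto simp: eigenvalue_def eigenvector_def)
  \<comment> \<open>Both sides come from moving the matrix across the Hermitian product of the
    eigenvector with itself, which is nonzero.\<close>
  have "z * (v \<bullet>c v) = cnj z * (v \<bullet>c v)"
    using symmetric_cscalar_prod[OF A sym v(1) v(1)] v by (simp add: conjugate_smult_vec)
  then have "z = cnj z"
    using v conjugate_square_eq_0_vec[OF v(1)] by simp
  then obtain x where x: "z = of_real x"
    by (metis Reals_cnj_iff Reals_cases)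
  \<comment> \<open>The eigenvector at hand is complex; the characteristic polynomial carries the
    eigenvalue back to the real matrix.\<close>
  have "poly (char_poly ?C) z = 0"
    using assms(3) eigenvalue_root_char_poly[OF C] by simp
  then have "poly (char_poly A) x = 0"
    using x by (simp add: of_real_hom.char_poly_hom[OF A])
  then have "x \<in> spectrum A"
    using eigenvalue_root_char_poly[OF A] by (simp add: spectrum_def)
  with x show ?thesis by blast
qed

text \<open>For \<open>u = (A - x) w\<close> with \<open>(A - x) u = 0\<close>, self-adjointness of
  \<open>A - x\<close> (\<open>x\<close> is real) gives \<open><u, u> = <w, (A - x) u> = 0\<close>,
  so \<open>u = 0\<close>.\<close>

lemma symmetric_semisimple:
  fixes A :: "real mat" and x :: real
  assumes A: "A \<in> carrier_mat n n" and sym: "\<And>i j. i < n \<Longrightarrow> j < n \<Longrightarrow> A $$ (i, j) = A $$ (j, i)"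
    and w: "w \<in> carrier_vec n"
    and "shift (map_mat complex_of_real A) (of_real x)
      (shift (map_mat complex_of_real A) (of_real x) w) = 0\<^sub>v n"
  shows "shift (map_mat complex_of_real A) (of_real x) w = 0\<^sub>v n"
proof -
  let ?C = "map_mat complex_of_real A"
  define u where "u = shift ?C (of_real x) w"
  have C: "?C \<in> carrier_mat n n" using A by simp
  have u: "u \<in> carrier_vec n" using C w by (simp add: u_def)
  have Cu: "?C *\<^sub>v u = of_real x \<cdot>\<^sub>v u"
    using assms(4) shift_eq_zero_iff[OF C u] by (simp add: u_def)
  have "u \<bullet>c u = (?C *\<^sub>v w) \<bullet>c u - (of_real x \<cdot>\<^sub>v w) \<bullet>c u"
    unfolding u_def[unfolded shift_def] using C w u
    by (subst minus_scalar_prod_distrib[of _ n]) (auto simp: u_def shift_def)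
  also have "\<dots> = 0"
    using symmetric_cscalar_prod[OF A sym w u] w u by (simp add: Cu conjugate_smult_vec)
  finally show ?thesis
    using conjugate_square_eq_0_vec[OF u] by (simp add: u_def)
qed

lemma symmetric_annihilated:
  fixes A :: "real mat"
  assumes A: "A \<in> carrier_mat n n" and sym: "\<And>i j. i < n \<Longrightarrow> j < n \<Longrightarrow> A $$ (i, j) = A $$ (j, i)"
  obtains zs where "length zs \<le> card (spectrum A)"
    "\<And>v. v \<in> carrier_vec n \<Longrightarrow> foldr (shift (map_mat complex_of_real A)) zs v = 0\<^sub>v n"
proof -
  let ?C = "map_mat complex_of_real A"
  have C: "?C \<in> carrier_mat n n" using A by simp
  obtain zs where zs: "\<And>v. v \<in> carrier_vec n \<Longrightarrow> foldr (shift ?C) zs v = 0\<^sub>v n"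
    using complex_mat_annihilated[OF C] by blast
  let ?zs = "remdups (filter (eigenvalue ?C) zs)"
  have "foldr (shift ?C) ?zs v = 0\<^sub>v n" if v: "v \<in> carrier_vec n" for v
  proof (rule foldr_shift_distinct_eigenvalues[OF C v _ zs[OF v]])
    fix z w
    assume "eigenvalue ?C z" and w: "w \<in> carrier_vec n" and 0: "shift ?C z (shift ?C z w) = 0\<^sub>v n"
    then obtain x where "z = of_real x"
      using symmetric_eigenvalue_real[OF A sym] by blast
    with 0 show "shift ?C z w = 0\<^sub>v n"
      using symmetric_semisimple[OF A sym w] by simp
  qed
  moreover have "length ?zs \<le> card (spectrum A)"
  proof -
    have "length ?zs = card (set ?zs)"
      by (rule distinct_card[symmetric]) simp
    also have "\<dots> \<le> card (complex_of_real ` spectrum A)"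
      using symmetric_eigenvalue_real[OF A sym] card_finite_spectrum(1)[OF A]
      by (intro card_mono) auto
    also have "\<dots> \<le> card (spectrum A)"
      using card_finite_spectrum(1)[OF A] by (rule card_image_le)
    finally show ?thesis .
  qed
  ultimately show thesis by (rule that[rotated])
qed

section \<open>The first nonzero power at a given entry\<close>

lemma pow_mat_foldr_shift:
  assumes A: "A \<in> carrier_mat n n" and u: "u \<in> carrier_vec n" and s: "s < n"
    and 0: "\<And>j. j < k \<Longrightarrow> (A ^\<^sub>m j *\<^sub>v u) $ s = 0" and "j + length zs \<le> k"
  shows "(A ^\<^sub>m j *\<^sub>v foldr (shift A) zs u) $ s = (A ^\<^sub>m (j + length zs) *\<^sub>v u) $ s"
  using assms(5)
proof (induction zs arbitrary: j)
  case (Cons z zs)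
  let ?w = "foldr (shift A) zs u"
  have w: "?w \<in> carrier_vec n" using A u by simp
  have Aj: "A ^\<^sub>m j \<in> carrier_mat n n" using A by simp
  have "A ^\<^sub>m j *\<^sub>v shift A z ?w = A ^\<^sub>m j *\<^sub>v (A *\<^sub>v ?w) - A ^\<^sub>m j *\<^sub>v (z \<cdot>\<^sub>v ?w)"
    unfolding shift_def[of A z] using A Aj w by (intro mult_minus_distrib_mat_vec[OF Aj]) auto
  also have "A ^\<^sub>m j *\<^sub>v (A *\<^sub>v ?w) = A ^\<^sub>m Suc j *\<^sub>v ?w"
    using assoc_mult_mat_vec[OF Aj A w] by simp
  also have "A ^\<^sub>m j *\<^sub>v (z \<cdot>\<^sub>v ?w) = z \<cdot>\<^sub>v (A ^\<^sub>m j *\<^sub>v ?w)"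
    using Aj w by (rule mult_mat_vec)
  finally have "(A ^\<^sub>m j *\<^sub>v shift A z ?w) $ s
      = (A ^\<^sub>m Suc j *\<^sub>v ?w) $ s - z * (A ^\<^sub>m j *\<^sub>v ?w) $ s"
    using A w s by (simp del: pow_mat.simps index_mult_mat_vec assoc_mult_mat_vec)
  \<comment> \<open>By the induction hypothesis this is the entry for exponent
    \<open>j + length zs\<close>, which is below \<open>k\<close> because the full list has one more
    factor. Only the leading term of the product survives.\<close>
  also have "(A ^\<^sub>m j *\<^sub>v ?w) $ s = 0"
    using Cons 0 by simp
  also have "(A ^\<^sub>m Suc j *\<^sub>v ?w) $ s = (A ^\<^sub>m (Suc j + length zs) *\<^sub>v u) $ s"
    using Cons.prems by (intro Cons.IH) simp
  finally show ?case by simp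
qed simp

lemma mult_mat_unit_vec_index:
  fixes A :: "'a :: comm_ring_1 mat"
  assumes "A \<in> carrier_mat n n" "s < n" "t < n"
  shows "(A *\<^sub>v unit_vec n t) $ s = A $$ (s, t)"
  using assms by simp

lemma symmetric_first_nonzero_power:
  fixes A :: "real mat"
  assumes A: "A \<in> carrier_mat n n" and sym: "\<And>i j. i < n \<Longrightarrow> j < n \<Longrightarrow> A $$ (i, j) = A $$ (j, i)"
    and st: "s < n" "t < n"
    and 0: "\<And>j. j < k \<Longrightarrow> (A ^\<^sub>m j) $$ (s, t) = 0" and k: "(A ^\<^sub>m k) $$ (s, t) \<noteq> 0"
  shows "k < card (spectrum A)"
proof (rule ccontr)
  assume "\<not> k < card (spectrum A)"
  let ?C = "map_mat complex_of_real A"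
  have C: "?C \<in> carrier_mat n n" using A by simp
  obtain zs where "length zs \<le> card (spectrum A)"
    and zs: "\<And>v. v \<in> carrier_vec n \<Longrightarrow> foldr (shift ?C) zs v = 0\<^sub>v n"
    using symmetric_annihilated[OF A sym] by blast
  then have len: "length zs \<le> k" using \<open>\<not> k < _\<close> by simp
  have entry: "(?C ^\<^sub>m j *\<^sub>v unit_vec n t) $ s = of_real ((A ^\<^sub>m j) $$ (s, t))" for j
  proof -
    have "?C ^\<^sub>m j = map_mat complex_of_real (A ^\<^sub>m j)"
      by (rule of_real_hom.mat_hom_pow[OF A, symmetric])
    then show ?thesis
      using mult_mat_unit_vec_index[of "?C ^\<^sub>m j" n s t] A st by simp
  qed
  \<comment> \<open>The extra power of \<open>?C\<close> raises the degree of the annihilating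
    product to exactly \<open>k\<close>; \<open>len\<close> ensures that the subtraction is not
    truncated.\<close>
  have "(?C ^\<^sub>m (k - length zs) *\<^sub>v foldr (shift ?C) zs (unit_vec n t)) $ s
      = (?C ^\<^sub>m (k - length zs + length zs) *\<^sub>v unit_vec n t) $ s"
    using len 0 by (intro pow_mat_foldr_shift[OF C _ st(1), where k = k]) (auto simp: entry)
  moreover have "?C ^\<^sub>m (k - length zs) *\<^sub>v 0\<^sub>v n = 0\<^sub>v n"
    using C by (intro eq_vecI) auto
  ultimately show False
    using len zs[of "unit_vec n t"] k st entry[of k] by simp
qed

section \<open>Walks and the signed diameter\<close>

text \<open>Only this direction holds in general, since walks of opposite signs can cancel.\<close>

lemma adj_matrix_pow_nonzero_awalk:
  assumes G: "signed_graph G \<sigma>" and vs: "set vs = pverts G"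
    and "s < length vs" "t < length vs" "(adj_matrix G \<sigma> vs ^\<^sub>m k) $$ (s, t) \<noteq> 0"
  shows "\<exists>p. pre_digraph.awalk (with_proj G) (vs ! s) p (vs ! t) \<and> length p = k"
  using assms(4,5)
proof (induction k arbitrary: t)
  case 0
  interpret signed_graph G \<sigma> by (rule G)
  have "s = t"
  proof (rule ccontr)
    assume "s \<noteq> t"
    then show False using 0 assms(3) by (simp add: adj_matrix_def)
  qed
  moreover have "vs ! s \<in> pverts G" using nth_mem[OF assms(3)] by (simp add: vs)
  ultimately show ?case by (intro exI[of _ "[]"]) (simp add: awalk_Nil_iff)
next
  case (Suc k)
  interpret signed_graph G \<sigma> by (rule G)
  let ?A = "adj_matrix G \<sigma> vs"
  let ?n = "length vs"
  have A: "?A \<in> carrier_mat ?n ?n" by (simp add: adj_matrix_def)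
  have "(?A ^\<^sub>m Suc k) $$ (s, t) = (\<Sum>i\<in>{0..<?n}. (?A ^\<^sub>m k) $$ (s, i) * ?A $$ (i, t))"
    using A \<open>s < ?n\<close> Suc.prems(1) by (simp add: scalar_prod_def)
  with Suc.prems(2) have "(\<Sum>i\<in>{0..<?n}. (?A ^\<^sub>m k) $$ (s, i) * ?A $$ (i, t)) \<noteq> 0"
    by argo
  \<comment> \<open>A nonzero summand names the penultimate vertex of the walk.\<close>
  then obtain i where "i \<in> {0..<?n}" "(?A ^\<^sub>m k) $$ (s, i) * ?A $$ (i, t) \<noteq> 0"
    by (rule sum.not_neutral_contains_not_neutral)
  then have i: "i < ?n" "(?A ^\<^sub>m k) $$ (s, i) \<noteq> 0" "?A $$ (i, t) \<noteq> 0"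
    by simp_all
  from i(1,3) Suc.prems(1) have arc: "(vs ! i, vs ! t) \<in> parcs G"
    by (simp add: adj_matrix_def split: if_splits)
  obtain p where "awalk (vs ! s) p (vs ! i)" "length p = k"
    using Suc.IH[OF i(1,2)] by blast
  moreover have "awalk (vs ! i) [(vs ! i, vs ! t)] (vs ! t)"
    using arc_implies_awalk[of "(vs ! i, vs ! t)"] arc by simp
  ultimately have "awalk (vs ! s) (p @ [(vs ! i, vs ! t)]) (vs ! t)"
    by (intro awalk_appendI)
  with \<open>length p = k\<close> show ?case by (intro exI[of _ "p @ [(vs ! i, vs ! t)]"]) simp
qed

theorem theorem3p4:
  fixes G :: "'a pair_pre_digraph" and \<sigma> :: "'a set \<Rightarrow> real" and vs :: "'a list" and m :: nat
  assumes "signed_graph G \<sigma>"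
    and "Digraph_Component.connected (with_proj G)"
    and "distinct vs" and "set vs = pverts G"
    and "card (spectrum (adj_matrix G \<sigma> vs)) = m"
  shows "int (signed_diameter G \<sigma> vs) \<le> int m - 1"
proof -
  interpret signed_graph G \<sigma> by fact
  let ?A = "adj_matrix G \<sigma> vs"
  let ?n = "length vs"
  let ?D = "{signed_dist G \<sigma> vs s t | s t. s < ?n \<and> t < ?n}"
  have A: "?A \<in> carrier_mat ?n ?n" by (simp add: adj_matrix_def)
  have arc_sym: "(u, v) \<in> parcs G \<longleftrightarrow> (v, u) \<in> parcs G" for u v
    using graph_symmetric by blast
  have sym: "?A $$ (i, j) = ?A $$ (j, i)" if "i < ?n" "j < ?n" for i j
    using that arc_sym[of "vs ! i" "vs ! j"] by (simp add: adj_matrix_def insert_commute)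
  have "pverts G \<noteq> {}"
    using assms(2) by (auto simp: Digraph_Component.connected_def strongly_connected_def)
  then have n: "0 < ?n" using assms(4) by auto
  \<comment> \<open>The zeroth power is the identity, whose diagonal entries are nonzero, so the
    bound applies with \<open>k = 0\<close>.\<close>
  have "0 < m"
    using symmetric_first_nonzero_power[OF A sym n n, of 0] assms(5) A n by simp
  have "d < m" if dD: "d \<in> ?D" for d
  proof -
    obtain s t where st: "s < ?n" "t < ?n" and d: "d = signed_dist G \<sigma> vs s t"
      using dD by blast
    define k where "k = graph_dist G (vs ! s) (vs ! t)"
    show ?thesis
    \<comment> \<open>If the entry vanishes, the signed distance has its default value 0, which is
      covered by \<open>0 < m\<close>. Otherwise it is \<open>k\<close>, and lower powers vanish at
      this entry because no walk is shorter than the distance.\<close>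
    proof (cases "(?A ^\<^sub>m k) $$ (s, t) = 0")
      case True
      then show ?thesis using \<open>0 < m\<close> d by (simp add: signed_dist_def k_def)
    next
      case False
      have "(?A ^\<^sub>m j) $$ (s, t) = 0" if "j < k" for j
      proof (rule ccontr)
        assume "(?A ^\<^sub>m j) $$ (s, t) \<noteq> 0"
        then have "k \<le> j"
          unfolding k_def graph_dist_def
          by (intro Least_le adj_matrix_pow_nonzero_awalk[OF assms(1,4) st])
        with that show False by simp
      qed
      then have "k < m"
        using symmetric_first_nonzero_power[OF A sym st _ False] assms(5) by blast
      with False d show ?thesis by (simp add: signed_dist_def k_def)
    qed
  qed
  moreover have "finite ?D"
    by (rule finite_subset[of _ "(\<lambda>(s, t). signed_dist G \<sigma> vs s t) ` ({..<?n} \<times> {..<?n})"]) auto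
  moreover have "?D \<noteq> {}" using n by blast
  ultimately have "signed_diameter G \<sigma> vs < m"
    unfolding signed_diameter_def by (subst Max_less_iff) blast+
  then show ?thesis by simp
qed

end
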